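(* Let $\mathcal{H}$ be a separable Hilbert space, let $K\in B(\mathcal{H})$ have closed range, let $\Psi=\{\psi_i\}_{i\in I}$ be a $K$-frame for $\mathcal{H}$ and let $\Phi=\{\phi_i\}_{i\in I}$ be a $K^{*}$-frame for $\mathcal{H}$. Then the following assertions hold. (1) If $R(T_{\Psi}^{*})\subseteq R(T_{\Phi}^{*}K^{*})$, then $\mathbb{M}_{1,\pi_{R(K)}\Psi,\Phi}$ has a $K$-right inverse which is of the form of a multiplier; that is, there is a multiplier $\mathcal{R}$ on $\mathcal{H}$ with $\mathbb{M}_{1,\pi_{R(K)}\Psi,\Phi}\mathcal{R}f=Kf$ for all $f\in\mathcal{H}$. (2) If $R(T_{\Phi}^{*})\subseteq R(T_{\Psi}^{*}K)$, then $\mathbb{M}_{1,\Psi,\Phi}$ on $R(K^{*})$ has a $K$-left inverse which is of the form of a multiplier; that is, there is a multiplier $\mathcal{L}$ on $\mathcal{H}$ with $\mathcal{L}\mathbb{M}_{1,\Psi,\Phi}f=Kf$ for all $f\in R(K^{*})$.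
   Context: $I$ is a countable index set, $\ell^2=\ell^2(I)$, $B(\mathcal{H})$ is the set of bounded linear operators on $\mathcal{H}$, and $R(L)$ is the range of an operator $L$. For a closed subspace $V$, $\pi_V$ is the orthogonal projection of $\mathcal{H}$ onto $V$. For $L\in B(\mathcal{H})$, a sequence $F=\{f_i\}_{i\in I}\subseteq\mathcal{H}$ is an $L$-frame for $\mathcal{H}$ if there are constants $A,B>0$ with $A\|L^{*}f\|^2\le\sum_{i\in I}|\langle f,f_i\rangle|^2\le B\|f\|^2$ for all $f\in\mathcal{H}$ (used here for $L=K$ and $L=K^{*}$). Every such $F$ is a Bessel sequence; its synthesis operator is $T_F:\ell^2\to\mathcal{H}$, $T_F(\{c_i\})=\sum_i c_if_i$, with adjoint $T_F^{*}f=\{\langle f,f_i\rangle\}_{i\in I}$. For sequences $\Phi=\{\phi_i\}_{i\in I}$, $\Psi=\{\psi_i\}_{i\in I}$ in $\mathcal{H}$ and a sequence $m=\{m_i\}_{i\in I}$ of complex scalars, the operator $\mathbb{M}_{m,\Phi,\Psi}:\mathcal{H}\to\mathcal{H}$, $\mathbb{M}_{m,\Phi,\Psi}f=\sum_{i\in I}m_i\langle f,\psi_i\rangle\phi_i$, is called a multiplier; the subscript $1$ means $m_i=1$ for all $i$, and $\pi_V\Psi=\{\pi_V\psi_i\}_{i\in I}$. *)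

theory Defs
  imports "HOL-Analysis.Analysis"
begin

section \<open>Complex Hilbert spaces\<close>

text \<open>
  A complex Hilbert space is a complete real inner product space carrying in addition a
  complex scalar multiplication that extends the real one, and a sesquilinear form
  (linear in the first, conjugate-linear in the second argument) whose real part is the
  real inner product. In particular \<open>norm x = sqrt (Re (cinner x x))\<close>.
\<close>

class complex_hilbert = real_inner + complete_space +
  fixes scaleC :: "complex \<Rightarrow> 'a \<Rightarrow> 'a"  (infixr \<open>*\<^sub>C\<close> 75)
    and cinner :: "'a \<Rightarrow> 'a \<Rightarrow> complex"
  assumes scaleC_add_right: "a *\<^sub>C (x + y) = a *\<^sub>C x + a *\<^sub>C y"
    and scaleC_add_left: "(a + b) *\<^sub>C x = a *\<^sub>C x + b *\<^sub>C x"
    and scaleC_scaleC: "a *\<^sub>C b *\<^sub>C x = (a * b) *\<^sub>C x"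
    and scaleR_scaleC: "r *\<^sub>R x = complex_of_real r *\<^sub>C x"
    and cinner_commute: "cinner x y = cnj (cinner y x)"
    and cinner_add_left: "cinner (x + y) z = cinner x z + cinner y z"
    and cinner_scaleC_left: "cinner (a *\<^sub>C x) y = a * cinner x y"
    and inner_eq_Re_cinner: "inner x y = Re (cinner x y)"

instantiation complex :: complex_hilbert
begin

definition scaleC_complex :: "complex \<Rightarrow> complex \<Rightarrow> complex" where
  "scaleC_complex a x = a * x"

definition cinner_complex :: "complex \<Rightarrow> complex \<Rightarrow> complex" where
  "cinner_complex x y = x * cnj y"

instance
  by standard
    (simp_all add: scaleC_complex_def cinner_complex_def algebra_simps inner_complex_def
      scaleR_conv_of_real)

end

definition csubspace :: "'a::complex_hilbert set \<Rightarrow> bool" where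
  "csubspace V \<longleftrightarrow> subspace V \<and> (\<forall>c. \<forall>x\<in>V. c *\<^sub>C x \<in> V)"

definition bounded_clinear :: "('a::complex_hilbert \<Rightarrow> 'b::complex_hilbert) \<Rightarrow> bool" where
  "bounded_clinear T \<longleftrightarrow> bounded_linear T \<and> (\<forall>c x. T (c *\<^sub>C x) = c *\<^sub>C T x)"

definition cadjoint ::
  "('a::complex_hilbert \<Rightarrow> 'b::complex_hilbert) \<Rightarrow> 'b \<Rightarrow> 'a" where
  "cadjoint T = (THE S. \<forall>x y. cinner (T x) y = cinner x (S y))"

definition orth_proj :: "'a::complex_hilbert set \<Rightarrow> 'a \<Rightarrow> 'a" where
  "orth_proj V x = (THE y. y \<in> V \<and> (\<forall>z\<in>V. cinner (x - y) z = 0))"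


section \<open>Frames and multipliers\<close>

text \<open>
  A sequence indexed by \<open>I\<close> is a function of which only the values on \<open>I\<close> matter. The index
  set carries no order, so all series are unordered (unconditionally convergent) sums.
  Elements of \<open>\<ell>\<^sup>2(I)\<close> are normalised to vanish outside \<open>I\<close>.
\<close>

definition ell2 :: "'i set \<Rightarrow> ('i \<Rightarrow> complex) set" where
  "ell2 I = {c. (\<forall>i. i \<notin> I \<longrightarrow> c i = 0) \<and> (\<lambda>i. (cmod (c i))\<^sup>2) summable_on I}"

definition bessel :: "'i set \<Rightarrow> ('i \<Rightarrow> 'a::complex_hilbert) \<Rightarrow> bool" where
  "bessel I F \<longleftrightarrow> (\<exists>B>0. \<forall>f. (\<lambda>i. (cmod (cinner f (F i)))\<^sup>2) summable_on I \<and>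
     (\<Sum>\<^sub>\<infinity>i\<in>I. (cmod (cinner f (F i)))\<^sup>2) \<le> B * (norm f)\<^sup>2)"

definition op_frame ::
  "'i set \<Rightarrow> ('a::complex_hilbert \<Rightarrow> 'a) \<Rightarrow> ('i \<Rightarrow> 'a) \<Rightarrow> bool" where
  "op_frame I L F \<longleftrightarrow> (\<exists>A>0. \<exists>B>0. \<forall>f.
     (\<lambda>i. (cmod (cinner f (F i)))\<^sup>2) summable_on I \<and>
     A * (norm (cadjoint L f))\<^sup>2 \<le> (\<Sum>\<^sub>\<infinity>i\<in>I. (cmod (cinner f (F i)))\<^sup>2) \<and>
     (\<Sum>\<^sub>\<infinity>i\<in>I. (cmod (cinner f (F i)))\<^sup>2) \<le> B * (norm f)\<^sup>2)"

definition synthesis ::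
  "'i set \<Rightarrow> ('i \<Rightarrow> 'a::complex_hilbert) \<Rightarrow> ('i \<Rightarrow> complex) \<Rightarrow> 'a" where
  "synthesis I F c = (\<Sum>\<^sub>\<infinity>i\<in>I. c i *\<^sub>C F i)"

text \<open>
  The adjoint of the synthesis operator; see \<open>synthesis_analysis_adjoint\<close> below.
\<close>

definition analysis ::
  "'i set \<Rightarrow> ('i \<Rightarrow> 'a::complex_hilbert) \<Rightarrow> 'a \<Rightarrow> 'i \<Rightarrow> complex" where
  "analysis I F f = (\<lambda>i. if i \<in> I then cinner f (F i) else 0)"

definition multiplier ::
  "'i set \<Rightarrow> ('i \<Rightarrow> complex) \<Rightarrow> ('i \<Rightarrow> 'a::complex_hilbert) \<Rightarrow> ('i \<Rightarrow> 'a) \<Rightarrow> 'a \<Rightarrow> 'a" where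
  "multiplier I m \<Phi> \<Psi> f = (\<Sum>\<^sub>\<infinity>i\<in>I. (m i * cinner f (\<Psi> i)) *\<^sub>C \<Phi> i)"

text \<open>
  Since \<open>infsum\<close> is total (with value \<open>0\<close> for divergent series), an operator is
  only called a multiplier if the defining series converges at every vector.
\<close>

definition is_multiplier :: "'i set \<Rightarrow> ('a::complex_hilbert \<Rightarrow> 'a) \<Rightarrow> bool" where
  "is_multiplier I M \<longleftrightarrow> (\<exists>m \<Phi> \<Psi>.
     (\<forall>f. (\<lambda>i. (m i * cinner f (\<Psi> i)) *\<^sub>C \<Phi> i) summable_on I) \<and> M = multiplier I m \<Phi> \<Psi>)"


subsection \<open>The projection, the adjoint and the synthesis operator are well defined\<close>

lemma cinner_add_right: "cinner x (y + z) = cinner x y + cinner x (z::'a::complex_hilbert)"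
  by (metis cinner_add_left cinner_commute complex_cnj_add)

lemma cinner_scaleC_right: "cinner x (a *\<^sub>C y) = cnj a * cinner x (y::'a::complex_hilbert)"
  by (metis cinner_scaleC_left cinner_commute complex_cnj_mult)

lemma cinner_zero_left [simp]: "cinner 0 (x::'a::complex_hilbert) = 0"
  using cinner_add_left[of 0 0 x] by simp

lemma cinner_zero_right [simp]: "cinner (x::'a::complex_hilbert) 0 = 0"
  using cinner_add_right[of x 0 0] by simp

lemma cinner_minus_left: "cinner (- x) y = - cinner x (y::'a::complex_hilbert)"
  using cinner_add_left[of x "- x" y] by (simp add: eq_neg_iff_add_eq_0 add.commute)

lemma cinner_minus_right: "cinner x (- y) = - cinner x (y::'a::complex_hilbert)"
  using cinner_add_right[of x y "- y"] by (simp add: eq_neg_iff_add_eq_0 add.commute)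

lemma cinner_diff_left: "cinner (x - y) z = cinner x z - cinner y (z::'a::complex_hilbert)"
  using cinner_add_left[of x "- y" z] by (simp add: cinner_minus_left)

lemma cinner_diff_right: "cinner x (y - z) = cinner x y - cinner x (z::'a::complex_hilbert)"
  using cinner_add_right[of x y "- z"] by (simp add: cinner_minus_right)

lemma cinner_self: "cinner x x = of_real ((norm (x::'a::complex_hilbert))\<^sup>2)"
proof -
  have "cinner x x \<in> \<real>"
    by (metis cinner_commute Reals_cnj_iff)
  moreover have "Re (cinner x x) = (norm x)\<^sup>2"
    by (simp add: inner_eq_Re_cinner[symmetric] power2_norm_eq_inner)
  ultimately show ?thesis
    by (metis of_real_Re)
qed

lemma cinner_ext:
  assumes "\<And>z. cinner z x = cinner z (y::'a::complex_hilbert)"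
  shows "x = y"
proof -
  have "cinner (x - y) (x - y) = 0"
    using assms[of "x - y"] by (simp add: cinner_diff_right)
  then show ?thesis
    by (simp add: cinner_self)
qed

lemma norm_scaleC: "norm (a *\<^sub>C x) = cmod a * norm (x::'a::complex_hilbert)"
proof -
  have "cinner (a *\<^sub>C x) (a *\<^sub>C x) = (a * cnj a) * cinner x x"
    by (simp add: cinner_scaleC_left cinner_scaleC_right)
  then have "complex_of_real ((norm (a *\<^sub>C x))\<^sup>2) = of_real ((cmod a * norm x)\<^sup>2)"
    unfolding cinner_self complex_norm_square[symmetric] of_real_mult[symmetric]
      of_real_power[symmetric] power_mult_distrib .
  then have "(norm (a *\<^sub>C x))\<^sup>2 = (cmod a * norm x)\<^sup>2"
    using of_real_eq_iff by blast
  then show ?thesis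
    by (simp add: power2_eq_iff_nonneg)
qed

lemma cinner_cauchy_schwarz: "cmod (cinner x y) \<le> norm x * norm (y::'a::complex_hilbert)"
proof (cases "cinner x y = 0")
  case False
  define u where "u = cnj (cinner x y) / of_real (cmod (cinner x y))"
  have u: "cmod u = 1"
    using False by (simp add: u_def norm_divide)
  have "cinner (u *\<^sub>C x) y = of_real (cmod (cinner x y))"
    using False
    by (simp add: u_def cinner_scaleC_left field_simps complex_norm_square[symmetric]
        power2_eq_square)
  then have "cmod (cinner x y) = inner (u *\<^sub>C x) y"
    by (simp add: inner_eq_Re_cinner)
  also have "\<dots> \<le> norm (u *\<^sub>C x) * norm y"
    by (rule norm_cauchy_schwarz)
  finally show ?thesis
    by (simp add: norm_scaleC u)
qed simp

lemma bounded_linear_cinner_left: "bounded_linear (\<lambda>x. cinner x (y::'a::complex_hilbert))"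
proof (rule bounded_linear_intro)
  show "cinner (r *\<^sub>R x) y = r *\<^sub>R cinner x y" for r x
    by (simp add: scaleR_scaleC[of r x] cinner_scaleC_left scaleR_conv_of_real)
  show "norm (cinner x y) \<le> norm x * norm y" for x
    by (rule cinner_cauchy_schwarz)
qed (rule cinner_add_left)

lemma orth_proj_exists:
  assumes V: "csubspace V" "closed V"
  shows "\<exists>!y. y \<in> V \<and> (\<forall>z\<in>V. cinner (x - y) z = 0)"
proof -
  have sub: "subspace V" and scale: "\<And>c v. v \<in> V \<Longrightarrow> c *\<^sub>C v \<in> V"
    using V by (auto simp: csubspace_def)
  define d where "d = (INF v\<in>V. (norm (x - v))\<^sup>2)"
  have bdd: "bdd_below ((\<lambda>v. (norm (x - v))\<^sup>2) ` V)"
    by (rule bdd_belowI[of _ 0]) auto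
  have ne: "V \<noteq> {}"
    using sub subspace_0 by blast
  have d_le: "d \<le> (norm (x - v))\<^sup>2" if "v \<in> V" for v
    unfolding d_def using bdd that by (rule cINF_lower)
  have "\<exists>v\<in>V. (norm (x - v))\<^sup>2 < d + 1 / Suc n" for n
    using cINF_less_iff[OF ne bdd, of "d + 1 / Suc n"] by (simp add: d_def)
  then obtain v where vV: "\<And>n. v n \<in> V" and v: "\<And>n. (norm (x - v n))\<^sup>2 < d + 1 / Suc n"
    by metis
  have para: "(norm (v m - v n))\<^sup>2 \<le> 2 / Suc m + 2 / Suc n" for m n
  proof -
    have "(1/2) *\<^sub>R (v m + v n) \<in> V"
      using sub vV by (simp add: subspace_add subspace_scale)
    then have "d \<le> (norm (x - (1/2) *\<^sub>R (v m + v n)))\<^sup>2"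
      by (rule d_le)
    moreover have "(norm (v m - v n))\<^sup>2 + 4 * (norm (x - (1/2) *\<^sub>R (v m + v n)))\<^sup>2
        = 2 * (norm (x - v m))\<^sup>2 + 2 * (norm (x - v n))\<^sup>2"
      unfolding power2_norm_eq_inner
      by (simp add: inner_diff_left inner_diff_right inner_add_left inner_add_right
          inner_commute algebra_simps)
    moreover have "2 / real (Suc k) = 2 * (1 / real (Suc k))" for k
      by simp
    ultimately show ?thesis
      using v[of m] v[of n] by linarith
  qed
  have "Cauchy v"
  proof (rule metric_CauchyI)
    fix e :: real assume "e > 0"
    then obtain N where N: "inverse (real (Suc N)) < e\<^sup>2 / 4"
      using reals_Archimedean[of "e\<^sup>2 / 4"] by auto
    have "dist (v m) (v n) < e" if "m \<ge> N" "n \<ge> N" for m n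
    proof -
      have "1 / real (Suc m) \<le> 1 / Suc N" "1 / real (Suc n) \<le> 1 / Suc N"
        using that by (simp_all add: frac_le)
      then have "(norm (v m - v n))\<^sup>2 < e\<^sup>2"
        using para[of m n] N by (simp add: inverse_eq_divide)
      then show ?thesis
        using \<open>e > 0\<close> by (simp add: dist_norm power2_less_imp_less)
    qed
    then show "\<exists>M. \<forall>m\<ge>M. \<forall>n\<ge>M. dist (v m) (v n) < e"
      by blast
  qed
  then obtain y where y: "v \<longlonglongrightarrow> y"
    by (meson Cauchy_convergent convergent_def)
  have yV: "y \<in> V"
    using V(2) vV y closed_sequentially by blast
  have "(\<lambda>n. (norm (x - v n))\<^sup>2) \<longlonglongrightarrow> (norm (x - y))\<^sup>2"
    by (intro tendsto_intros y)
  moreover have "(\<lambda>n. d + 1 / real (Suc n)) \<longlonglongrightarrow> d + 0"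
    by (intro tendsto_add tendsto_const LIMSEQ_Suc[OF lim_1_over_n])
  ultimately have y_le: "(norm (x - y))\<^sup>2 \<le> d"
    using v by (intro LIMSEQ_le) (auto intro: less_imp_le)
  have orth: "cinner (x - y) z = 0" if "z \<in> V" for z
  proof (cases "z = 0")
    case False
    define c where "c = cinner (x - y) z / of_real ((norm z)\<^sup>2)"
    have "y + c *\<^sub>C z \<in> V"
      using sub yV scale that by (simp add: subspace_add)
    then have "(norm (x - y))\<^sup>2 \<le> (norm (x - (y + c *\<^sub>C z)))\<^sup>2"
      using y_le d_le by (meson order_trans)
    also have "\<dots> = (norm (x - y))\<^sup>2 - 2 * Re (cinner (x - y) (c *\<^sub>C z)) + (norm (c *\<^sub>C z))\<^sup>2"
      unfolding inner_eq_Re_cinner[symmetric] power2_norm_eq_inner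
      by (simp add: inner_diff_left inner_diff_right inner_add_left inner_add_right
          inner_commute algebra_simps)
    finally have "2 * Re (cinner (x - y) (c *\<^sub>C z)) \<le> (cmod c * norm z)\<^sup>2"
      by (simp add: norm_scaleC)
    moreover have "cinner (x - y) (c *\<^sub>C z) = of_real ((cmod c * norm z)\<^sup>2)"
    proof -
      have "cinner (x - y) z = c * of_real ((norm z)\<^sup>2)"
        using False by (simp add: c_def)
      then show ?thesis
        using complex_norm_square[of c]
        by (simp add: cinner_scaleC_right power_mult_distrib mult_ac)
    qed
    ultimately have "(cmod c * norm z)\<^sup>2 \<le> 0"
      by simp
    then have "c = 0"
      using False by simp
    then show ?thesis
      using False by (simp add: c_def)
  qed simp
  show ?thesis
  proof (rule ex1I[of _ y])
    fix w assume w: "w \<in> V \<and> (\<forall>z\<in>V. cinner (x - w) z = 0)"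
    have "y - w \<in> V"
      using sub w yV by (simp add: subspace_diff)
    then have "cinner (x - w) (y - w) - cinner (x - y) (y - w) = 0"
      using w orth by simp
    then have "cinner (y - w) (y - w) = 0"
      by (simp add: cinner_diff_left)
    then show "w = y"
      by (simp add: cinner_self)
  qed (use yV orth in auto)
qed

lemma orth_proj:
  assumes "csubspace V" "closed V"
  shows "orth_proj V x \<in> V" and "z \<in> V \<Longrightarrow> cinner (x - orth_proj V x) z = 0"
  using theI'[OF orth_proj_exists[OF assms, of x]] unfolding orth_proj_def by auto

lemma riesz_representation:
  fixes \<phi> :: "'a::complex_hilbert \<Rightarrow> complex"
  assumes "bounded_linear \<phi>" and hom: "\<And>c x. \<phi> (c *\<^sub>C x) = c * \<phi> x"
  shows "\<exists>y. \<forall>x. \<phi> x = cinner x y"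
proof (cases "\<forall>x. \<phi> x = 0")
  case True
  then show ?thesis
    by (metis cinner_zero_right)
next
  case False
  then obtain u where u: "\<phi> u \<noteq> 0"
    by blast
  interpret bounded_linear \<phi> by fact
  define V where "V = {x. \<phi> x = 0}"
  have V: "csubspace V"
    unfolding csubspace_def V_def subspace_def by (auto simp: add zero hom scaleR)
  have "closed V"
    unfolding V_def by (intro closed_Collect_eq continuous_intros continuous_on)
  note P = orth_proj[OF V this]
  define z where "z = u - orth_proj V u"
  have z: "\<phi> z \<noteq> 0"
    using P(1)[of u] u by (simp add: z_def diff V_def)
  then have z0: "norm z \<noteq> 0"
    using zero by auto
  define y where "y = (cnj (\<phi> z) / of_real ((norm z)\<^sup>2)) *\<^sub>C z"
  have "\<phi> x = cinner x y" for x
  proof -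
    have "x - (\<phi> x / \<phi> z) *\<^sub>C z \<in> V"
      using z by (simp add: V_def diff hom)
    then have "cinner z (x - (\<phi> x / \<phi> z) *\<^sub>C z) = 0"
      unfolding z_def by (rule P(2))
    then have "cinner (x - (\<phi> x / \<phi> z) *\<^sub>C z) z = 0"
      by (metis cinner_commute complex_cnj_zero)
    then have "cinner x z = \<phi> x / \<phi> z * of_real ((norm z)\<^sup>2)"
      by (simp add: cinner_diff_left cinner_scaleC_left cinner_self)
    then show ?thesis
      using z z0 by (simp add: y_def cinner_scaleC_right)
  qed
  then show ?thesis by blast
qed

lemma cadjoint_exists:
  fixes T :: "'a::complex_hilbert \<Rightarrow> 'b::complex_hilbert"
  assumes "bounded_clinear T"
  shows "\<exists>!S. \<forall>x y. cinner (T x) y = cinner x (S y)"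
proof -
  have T: "bounded_linear T" and hom: "\<And>c x. T (c *\<^sub>C x) = c *\<^sub>C T x"
    using assms by (auto simp: bounded_clinear_def)
  have "\<exists>s. \<forall>x. cinner (T x) y = cinner x s" for y
    by (rule riesz_representation)
      (simp_all add: hom cinner_scaleC_left bounded_linear_compose[OF bounded_linear_cinner_left T])
  then obtain S where S: "\<And>x y. cinner (T x) y = cinner x (S y)"
    by metis
  show ?thesis
  proof (rule ex1I[of _ S])
    fix S' assume S': "\<forall>x y. cinner (T x) y = cinner x (S' y)"
    show "S' = S"
    proof
      fix y show "S' y = S y"
        by (rule cinner_ext) (metis S S')
    qed
  qed (use S in blast)
qed

lemma cadjoint:
  assumes "bounded_clinear T"
  shows "cinner (T x) y = cinner x (cadjoint T y)"
  using theI'[OF cadjoint_exists[OF assms]] unfolding cadjoint_def by blast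

lemma op_frame_imp_bessel: "op_frame I L F \<Longrightarrow> bessel I F"
  unfolding op_frame_def bessel_def by meson

lemma analysis_in_ell2: "bessel I F \<Longrightarrow> analysis I F f \<in> ell2 I"
  by (auto simp: bessel_def analysis_def ell2_def cong: summable_on_cong)

lemma synthesis_summable:
  fixes F :: "'i \<Rightarrow> 'a::complex_hilbert"
  assumes "bessel I F" and c: "c \<in> ell2 I"
  shows "(\<lambda>i. c i *\<^sub>C F i) summable_on I"
proof -
  obtain B where B: "B > 0"
    and Bs: "\<And>f. (\<lambda>i. (cmod (cinner f (F i)))\<^sup>2) summable_on I"
    and Bb: "\<And>f. (\<Sum>\<^sub>\<infinity>i\<in>I. (cmod (cinner f (F i)))\<^sup>2) \<le> B * (norm f)\<^sup>2"
    using assms(1) unfolding bessel_def by blast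
  define g where "g i = (cmod (c i))\<^sup>2" for i
  have g: "g summable_on I"
    using c by (simp add: ell2_def g_def[abs_def])
  have bound: "(norm (\<Sum>i\<in>J. c i *\<^sub>C F i))\<^sup>2 \<le> B * sum g J" if J: "finite J" "J \<subseteq> I" for J
  proof -
    define v where "v = (\<Sum>i\<in>J. c i *\<^sub>C F i)"
    have lin: "cinner v v = (\<Sum>i\<in>J. c i * cinner (F i) v)"
    proof -
      have "cinner v w = (\<Sum>i\<in>J. c i * cinner (F i) w)" for w
        unfolding v_def using J(1)
        by (induction J) (simp_all add: cinner_add_left cinner_scaleC_left)
      then show ?thesis .
    qed
    have "(norm v)\<^sup>2 = cmod (cinner v v)"
      by (simp add: cinner_self norm_power)
    also have "\<dots> \<le> (\<Sum>i\<in>J. cmod (c i * cinner (F i) v))"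
      unfolding lin by (rule norm_sum)
    also have "\<dots> = (\<Sum>i\<in>J. \<bar>cmod (c i)\<bar> * \<bar>cmod (cinner v (F i))\<bar>)"
      by (rule sum.cong) (simp_all add: norm_mult, metis cinner_commute complex_mod_cnj)
    also have "\<dots> \<le> L2_set (\<lambda>i. cmod (c i)) J * L2_set (\<lambda>i. cmod (cinner v (F i))) J"
      by (rule L2_set_mult_ineq)
    also have "\<dots> \<le> sqrt (sum g J) * (sqrt B * norm v)"
    proof (rule mult_mono)
      have "(\<Sum>i\<in>J. (cmod (cinner v (F i)))\<^sup>2) \<le> (\<Sum>\<^sub>\<infinity>i\<in>I. (cmod (cinner v (F i)))\<^sup>2)"
        using J Bs by (intro finite_sum_le_infsum) auto
      also note Bb[of v]
      finally have "L2_set (\<lambda>i. cmod (cinner v (F i))) J \<le> sqrt (B * (norm v)\<^sup>2)"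
        unfolding L2_set_def by (rule real_sqrt_le_mono)
      then show "L2_set (\<lambda>i. cmod (cinner v (F i))) J \<le> sqrt B * norm v"
        by (simp add: real_sqrt_mult)
    qed (simp_all add: L2_set_def g_def sum_nonneg)
    finally have *: "norm v * norm v \<le> (sqrt (B * sum g J)) * norm v"
      by (simp add: power2_eq_square real_sqrt_mult mult_ac)
    have "norm v \<le> sqrt (B * sum g J)"
    proof (cases "norm v = 0")
      case True
      then show ?thesis using B by (simp add: g_def sum_nonneg)
    next
      case False
      then show ?thesis using * by (simp add: mult_le_cancel_right)
    qed
    then have "(norm v)\<^sup>2 \<le> (sqrt (B * sum g J))\<^sup>2"
      by (intro power_mono) auto
    then show ?thesis
      using B by (simp add: v_def g_def sum_nonneg)
  qed
  let ?f = "\<lambda>i. c i *\<^sub>C F i"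
  have "\<exists>P. eventually P (finite_subsets_at_top I) \<and>
      (\<forall>J J'. P J \<and> P J' \<longrightarrow> dist (sum ?f J) (sum ?f J') < e)" if "e > 0" for e
  proof -
    define d where "d = e\<^sup>2 / (8 * B)"
    have d: "d > 0" using that B by (simp add: d_def)
    obtain M where M: "finite M" "M \<subseteq> I" "dist (sum g M) (infsum g I) \<le> d"
      using infsum_finite_approximation[OF g d] by blast
    have near: "norm (sum ?f J - sum ?f M) < e / 2" if J: "finite J" "J \<subseteq> I" "M \<subseteq> J" for J
    proof -
      have "sum g J \<le> infsum g I"
        using J g by (intro finite_sum_le_infsum) (auto simp: g_def)
      moreover have "sum g (J - M) = sum g J - sum g M"
        using J by (simp add: sum_diff)
      ultimately have "sum g (J - M) \<le> d"
        using M(3) by (simp add: dist_real_def)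
      then have "B * sum g (J - M) \<le> B * d"
        using B by simp
      also have "\<dots> < (e / 2)\<^sup>2"
        using B \<open>e > 0\<close> by (simp add: d_def power2_eq_square)
      finally have "(norm (sum ?f (J - M)))\<^sup>2 < (e / 2)\<^sup>2"
        using bound[of "J - M"] J by (auto intro: le_less_trans)
      then have "norm (sum ?f (J - M)) < e / 2"
        using \<open>e > 0\<close> by (intro power2_less_imp_less[of _ "e / 2"]) auto
      then show ?thesis
        using J by (simp add: sum_diff)
    qed
    show ?thesis
    proof (intro exI conjI allI impI)
      show "eventually (\<lambda>J. finite J \<and> J \<subseteq> I \<and> M \<subseteq> J) (finite_subsets_at_top I)"
        using M by (auto simp: eventually_finite_subsets_at_top)
      fix J J' assume "(finite J \<and> J \<subseteq> I \<and> M \<subseteq> J) \<and> (finite J' \<and> J' \<subseteq> I \<and> M \<subseteq> J')"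
      then have "norm (sum ?f J - sum ?f M) < e / 2" "norm (sum ?f J' - sum ?f M) < e / 2"
        using near by auto
      then show "dist (sum ?f J) (sum ?f J') < e"
        unfolding dist_norm by (rule norm_triangle_half_l)
    qed
  qed
  then have "cauchy_filter (filtermap (sum ?f) (finite_subsets_at_top I))"
    by (simp add: cauchy_filter_metric_filtermap)
  moreover have "complete (UNIV :: 'a set)"
    by (meson Cauchy_convergent UNIV_I complete_def convergent_def)
  ultimately obtain s where "(sum ?f \<longlongrightarrow> s) (finite_subsets_at_top I)"
    using complete_uniform[where S="UNIV :: 'a set"] by (force simp add: filterlim_def)
  then show ?thesis
    using summable_on_def has_sum_def by blast
qed

lemma synthesis_analysis_adjoint:
  assumes "bessel I F" and "c \<in> ell2 I"
  shows "((\<lambda>i. c i * cnj (analysis I F f i)) has_sum cinner (synthesis I F c) f) I"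
proof -
  have "((\<lambda>i. c i *\<^sub>C F i) has_sum synthesis I F c) I"
    unfolding synthesis_def using synthesis_summable[OF assms] by (rule has_sum_infsum)
  then have "((\<lambda>i. cinner (c i *\<^sub>C F i) f) has_sum cinner (synthesis I F c) f) I"
    by (rule has_sum_bounded_linear[OF bounded_linear_cinner_left])
  moreover have "cinner (c i *\<^sub>C F i) f = c i * cnj (analysis I F f i)" if "i \<in> I" for i
    using that cinner_commute[of "F i" f] by (simp add: analysis_def cinner_scaleC_left)
  ultimately show ?thesis
    by (simp cong: has_sum_cong)
qed

lemma multiplier_one_summable:
  assumes "bessel I \<Phi>" and "bessel I \<Psi>"
  shows "(\<lambda>i. (1 * cinner f (\<Psi> i)) *\<^sub>C \<Phi> i) summable_on I"
  using synthesis_summable[OF assms(1) analysis_in_ell2[OF assms(2), of f]]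
  by (simp add: analysis_def cong: summable_on_cong)

end

(*
  Let V be the range of K, U the range of its adjoint, and N(F,G) the multiplier with symbol 1.
  Since V is closed, the adjoint of K is bounded below on V (uniform boundedness), hence K is
  bounded below on U and U is closed as well. The lower frame bounds then say that the compressions
  of N(Psi,Psi) to V and of N(Phi,Phi) to U are coercive; by Lax-Milgram they have bounded inverses
  B and C. If the coefficients of h with respect to Psi are those of some y in U with respect to
  Phi, then C N(Phi,Psi) h = C N(Phi,Phi) y = y. Hence, for D = C N(Phi,Psi) B, the operator D K is
  a K-right inverse in (1), and symmetrically K D is a K-left inverse in (2). Both are multipliers,
  because X N(Phi,Psi) Y = N(X Phi, Y' Psi) with Y' the adjoint of Y.
*)
theory Submission
  imports Defs
begin

section \<open>Bounded operators and orthogonal projections\<close>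

lemma bounded_clinearI:
  assumes add: "\<And>x y. T (x + y) = T x + T y"
    and scale: "\<And>c x. T (c *\<^sub>C x) = c *\<^sub>C T x"
    and bound: "\<And>x. norm (T x) \<le> norm x * B"
  shows "bounded_clinear T"
proof -
  have "bounded_linear T"
  proof (rule bounded_linear_intro)
    show "T (r *\<^sub>R x) = r *\<^sub>R T x" for r x
      by (simp only: scaleR_scaleC scale)
  qed (fact add bound)+
  then show ?thesis
    using scale by (simp add: bounded_clinear_def)
qed

lemma bounded_clinear_linear: "bounded_clinear T \<Longrightarrow> bounded_linear T"
  by (simp add: bounded_clinear_def)

lemma bounded_clinear_scaleC: "bounded_clinear T \<Longrightarrow> T (c *\<^sub>C x) = c *\<^sub>C T x"
  by (simp add: bounded_clinear_def)

lemma bounded_clinear_compose: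
  "bounded_clinear S \<Longrightarrow> bounded_clinear T \<Longrightarrow> bounded_clinear (\<lambda>x. S (T x))"
  by (simp add: bounded_clinear_def bounded_linear_compose)

lemma csubspace_image:
  assumes "bounded_clinear T" "csubspace V"
  shows "csubspace (T ` V)"
proof -
  have "subspace (T ` V)"
    using assms linear_subspace_image[of T V]
    by (auto simp: bounded_clinear_def csubspace_def bounded_linear.linear)
  moreover have "c *\<^sub>C T x \<in> T ` V" if "x \<in> V" for c x
    using that assms by (metis bounded_clinear_scaleC csubspace_def imageI)
  ultimately show ?thesis
    by (auto simp: csubspace_def)
qed

lemma csubspace_range: "bounded_clinear T \<Longrightarrow> csubspace (range T)"
  by (rule csubspace_image) (auto simp: csubspace_def)

text \<open>Uniqueness of the nearest point; additivity and homogeneity of the projection are read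
  off from it.\<close>

lemma orth_proj_eqI:
  assumes "csubspace V" "closed V" "y \<in> V" "\<And>z. z \<in> V \<Longrightarrow> cinner (x - y) z = 0"
  shows "orth_proj V x = y"
  unfolding orth_proj_def
  by (rule the1_equality[OF orth_proj_exists[OF assms(1,2)]]) (use assms(3,4) in auto)

lemma orth_proj_id: "csubspace V \<Longrightarrow> closed V \<Longrightarrow> x \<in> V \<Longrightarrow> orth_proj V x = x"
  by (rule orth_proj_eqI) auto

lemma cinner_orth_proj_left:
  "csubspace V \<Longrightarrow> closed V \<Longrightarrow> z \<in> V \<Longrightarrow> cinner (orth_proj V x) z = cinner x z"
  using orth_proj(2)[of V z x] by (simp add: cinner_diff_left)

lemma cinner_orth_proj_right:
  "csubspace V \<Longrightarrow> closed V \<Longrightarrow> z \<in> V \<Longrightarrow> cinner z (orth_proj V x) = cinner z x"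
  by (metis cinner_commute cinner_orth_proj_left)

lemma Re_cinner_self: "Re (cinner x x) = (norm x)\<^sup>2"
  by (simp add: cinner_self)

lemma Re_cinner_le: "Re (cinner x y) \<le> norm x * norm y"
  by (metis complex_Re_le_cmod cinner_cauchy_schwarz order_trans)

lemma norm_orth_proj_le:
  assumes V: "csubspace V" "closed V"
  shows "norm (orth_proj V x) \<le> norm x"
proof -
  \<comment> \<open>The residual is orthogonal to the projection, so \<open>x\<close> may replace it
    in one slot of the inner product.\<close>
  have "(norm (orth_proj V x))\<^sup>2 \<le> norm x * norm (orth_proj V x)"
    using Re_cinner_self[of "orth_proj V x"] Re_cinner_le[of x "orth_proj V x"]
    by (simp add: cinner_orth_proj_left[OF V orth_proj(1)[OF V]])
  then show ?thesis
    by (cases "norm (orth_proj V x) = 0") (simp_all add: power2_eq_square)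
qed

lemma bounded_clinear_orth_proj:
  assumes V: "csubspace V" "closed V"
  shows "bounded_clinear (orth_proj V)"
proof (rule bounded_clinearI[where B = 1])
  note P = orth_proj[OF V] and sub = V(1)[unfolded csubspace_def]
  show "orth_proj V (x + y) = orth_proj V x + orth_proj V y" for x y
  proof (rule orth_proj_eqI[OF V])
    show "orth_proj V x + orth_proj V y \<in> V"
      using P(1) sub by (simp add: subspace_add)
    show "cinner (x + y - (orth_proj V x + orth_proj V y)) z = 0" if "z \<in> V" for z
      using that by (simp add: cinner_diff_left cinner_add_left cinner_orth_proj_left[OF V])
  qed
  show "orth_proj V (c *\<^sub>C x) = c *\<^sub>C orth_proj V x" for c x
  proof (rule orth_proj_eqI[OF V])
    show "c *\<^sub>C orth_proj V x \<in> V"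
      using P(1) sub by simp
    show "cinner (c *\<^sub>C x - c *\<^sub>C orth_proj V x) z = 0" if "z \<in> V" for z
      using that by (simp add: cinner_diff_left cinner_scaleC_left cinner_orth_proj_left[OF V])
  qed
  show "norm (orth_proj V x) \<le> norm x * 1" for x
    using norm_orth_proj_le[OF V] by simp
qed

section \<open>Adjoints and closed range\<close>

lemma bounded_clinear_cadjoint:
  assumes "bounded_clinear T"
  shows "bounded_clinear (cadjoint T)"
proof -
  obtain B where B: "B \<ge> 0" "\<And>x. norm (T x) \<le> norm x * B"
    using bounded_linear.nonneg_bounded[OF bounded_clinear_linear[OF assms]] by blast
  show ?thesis
  proof (rule bounded_clinearI[where B = B])
    show "cadjoint T (x + y) = cadjoint T x + cadjoint T y" for x y
      by (rule cinner_ext) (simp add: cadjoint[OF assms, symmetric] cinner_add_right)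
    show "cadjoint T (c *\<^sub>C x) = c *\<^sub>C cadjoint T x" for c x
      by (rule cinner_ext) (simp add: cadjoint[OF assms, symmetric] cinner_scaleC_right)
    show "norm (cadjoint T x) \<le> norm x * B" for x
    proof -
      \<comment> \<open>Testing the adjoint relation at \<open>?y\<close> itself gives a quadratic
        estimate; one factor \<open>norm ?y\<close> then cancels, so \<open>T\<close> and its
        adjoint share the bound \<open>B\<close>.\<close>
      let ?y = "cadjoint T x"
      have "(norm ?y)\<^sup>2 = Re (cinner (T ?y) x)"
        by (simp add: cadjoint[OF assms] Re_cinner_self)
      also have "\<dots> \<le> norm (T ?y) * norm x"
        by (rule Re_cinner_le)
      also have "\<dots> \<le> norm ?y * B * norm x"
        by (intro mult_right_mono B(2)) simp
      finally have *: "norm ?y * norm ?y \<le> (norm x * B) * norm ?y"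
        by (simp add: power2_eq_square mult_ac)
      show ?thesis
      proof (cases "norm ?y = 0")
        case True
        with B(1) show ?thesis by simp
      next
        case False
        with * show ?thesis by (simp add: mult_le_cancel_right)
      qed
    qed
  qed
qed

text \<open>The lower frame bound of a \<open>cadjoint K\<close>-frame involves the double adjoint;
  this turns it into a bound by \<open>K\<close>.\<close>

lemma cadjoint_cadjoint:
  assumes "bounded_clinear T"
  shows "cadjoint (cadjoint T) = T"
proof
  fix x show "cadjoint (cadjoint T) x = T x"
    by (rule cinner_ext)
      (metis assms bounded_clinear_cadjoint cadjoint cinner_commute)
qed

text \<open>Uniform boundedness principle for the functionals given by \<open>W\<close>. By Baire,
  one of the closed sets \<open>E n\<close> contains a ball, and linearity carries the bound on that
  ball to all directions.\<close>

lemma uniformly_bounded_functionals: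
  fixes W :: "'a::complex_hilbert set"
  assumes "\<And>u. \<exists>b. \<forall>w\<in>W. cmod (cinner u w) \<le> b"
  shows "\<exists>C>0. \<forall>w\<in>W. norm w \<le> C"
proof -
  define E where "E n = {u. \<forall>w\<in>W. cmod (cinner u w) \<le> real n}" for n
  have "closed (E n)" for n
  proof -
    have "E n = (\<Inter>w\<in>W. {u. cmod (cinner u w) \<le> real n})"
      by (auto simp: E_def)
    moreover have "closed {u. cmod (cinner u w) \<le> real n}" for w
      by (intro closed_Collect_le continuous_intros
          linear_continuous_on[OF bounded_linear_cinner_left])
    ultimately show ?thesis
      by auto
  qed
  have "u \<in> (\<Union>n. E n)" for u
  proof -
    obtain b where "\<forall>w\<in>W. cmod (cinner u w) \<le> b"
      using assms by blast
    moreover obtain n where "b \<le> real n"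
      using real_arch_simple by blast
    ultimately have "u \<in> E n"
      by (auto simp: E_def intro: order_trans)
    then show ?thesis by blast
  qed
  then have "(\<Union>n. E n) = UNIV"
    by blast
  moreover have "euclidean interior_of \<Union>(range E) = {}" if "\<And>n. interior (E n) = {}"
    using that \<open>\<And>n. closed (E n)\<close>
    by (intro Baire_category_alt) (auto simp: completely_metrizable_space_euclidean)
  ultimately obtain n where "interior (E n) \<noteq> {}"
    by auto
  then obtain u0 r where r: "r > 0" "ball u0 r \<subseteq> E n"
    by (metis ex_in_conv mem_interior)
  \<comment> \<open>A multiple of \<open>w\<close> of length \<open>r / 2\<close> is compared at
    \<open>u0 + v\<close> and \<open>u0\<close>, which gives \<open>4 * n / r\<close>; the added 1
    keeps the constant positive for \<open>n = 0\<close>.\<close>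
  have "norm w \<le> (4 * real n + 1) / r" if w: "w \<in> W" for w
  proof (cases "w = 0")
    case False
    define v where "v = (r / (2 * norm w)) *\<^sub>R w"
    have "norm v = r / 2"
      using False r by (simp add: v_def)
    then have "u0 + v \<in> E n" "u0 \<in> E n"
      using r by (auto simp: dist_norm)
    then have "cmod (cinner (u0 + v) w - cinner u0 w) \<le> real n + real n"
      using w by (intro order_trans[OF norm_triangle_ineq4] add_mono) (auto simp: E_def)
    then have "cmod (cinner v w) \<le> 2 * real n"
      by (simp add: cinner_add_left)
    moreover have "cinner v w = of_real (r / 2 * norm w)"
      using False
      by (simp add: v_def scaleR_scaleC[of _ w] cinner_scaleC_left cinner_self power2_eq_square)
    then have "cmod (cinner v w) = r / 2 * norm w"
      using r by (simp del: of_real_mult of_real_divide)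
    ultimately show ?thesis
      using r by (simp add: field_simps)
  qed (use r in simp)
  moreover have "(4 * real n + 1) / r > 0"
    using r by (simp add: add_nonneg_pos)
  ultimately show ?thesis
    by blast
qed

text \<open>Closedness lets every \<open>u\<close> be projected to some \<open>K x\<close> in the
  range. For \<open>w\<close> in \<open>W\<close> the product of \<open>u\<close> and
  \<open>w\<close> is then that of \<open>x\<close> and \<open>cadjoint K w\<close>, at most
  \<open>norm x\<close>; uniform boundedness of \<open>W\<close> yields the constant.\<close>

lemma closed_range_imp_cadjoint_bounded_below:
  fixes K :: "'a::complex_hilbert \<Rightarrow> 'b::complex_hilbert"
  assumes K: "bounded_clinear K" and cl: "closed (range K)"
  shows "\<exists>c>0. \<forall>v\<in>range K. c * norm v \<le> norm (cadjoint K v)"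
proof -
  note V = csubspace_range[OF K] cl
  interpret A: bounded_linear "cadjoint K"
    by (rule bounded_clinear_linear[OF bounded_clinear_cadjoint[OF K]])
  define W where "W = {w \<in> range K. norm (cadjoint K w) \<le> 1}"
  have "\<exists>b. \<forall>w\<in>W. cmod (cinner u w) \<le> b" for u
  proof -
    obtain x where x: "orth_proj (range K) u = K x"
      using orth_proj(1)[OF V, of u] by blast
    have "cmod (cinner u w) \<le> norm x" if "w \<in> W" for w
    proof -
      have "cinner u w = cinner x (cadjoint K w)"
        using that cinner_orth_proj_left[OF V, of w u] cadjoint[OF K, of x w] x
        by (simp add: W_def)
      also have "cmod \<dots> \<le> norm x * norm (cadjoint K w)"
        by (rule cinner_cauchy_schwarz)
      also have "\<dots> \<le> norm x * 1"
        using that by (intro mult_left_mono) (auto simp: W_def)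
      finally show ?thesis by simp
    qed
    then show ?thesis by blast
  qed
  from uniformly_bounded_functionals[OF this]
  obtain C where C: "C > 0" "\<And>w. w \<in> W \<Longrightarrow> norm w \<le> C"
    by blast
  have "1 / C * norm v \<le> norm (cadjoint K v)" if v: "v \<in> range K" for v
  proof (cases "cadjoint K v = 0")
    \<comment> \<open>Here \<open>v\<close> cannot be rescaled into \<open>W\<close>, but as a value
      of \<open>K\<close> it is orthogonal to itself, hence zero.\<close>
    case True
    obtain x where "v = K x" using v by blast
    then have "cinner v v = 0"
      using cadjoint[OF K, of x v] True by simp
    then show ?thesis
      using True by (simp add: cinner_self)
  next
    case False
    let ?w = "inverse (norm (cadjoint K v)) *\<^sub>R v"
    have "?w \<in> W"
      using False v V(1) by (simp add: W_def A.scaleR csubspace_def subspace_scale)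
    then have "norm ?w \<le> C"
      by (rule C(2))
    then show ?thesis
      using False C(1) by (simp add: field_simps)
  qed
  then show ?thesis
    using C(1) by (intro exI[of _ "1 / C"]) simp
qed

text \<open>The adjoint kills the orthogonal complement of the range, so every value is attained at
  some \<open>v\<close> in the range. Then the square of \<open>norm g\<close> is at most
  \<open>norm (K g) * norm v\<close>, and \<open>c * norm v \<le> norm g\<close> transfers the same
  constant to \<open>K\<close>.\<close>

lemma bounded_below_on_range_cadjoint:
  fixes K :: "'a::complex_hilbert \<Rightarrow> 'b::complex_hilbert"
  assumes K: "bounded_clinear K" and cl: "closed (range K)" and "c > 0"
    and below: "\<And>v. v \<in> range K \<Longrightarrow> c * norm v \<le> norm (cadjoint K v)"
  shows "range (cadjoint K) = cadjoint K ` range K"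
    and "g \<in> range (cadjoint K) \<Longrightarrow> c * norm g \<le> norm (K g)"
proof -
  note V = csubspace_range[OF K] cl
  have "cadjoint K u = cadjoint K (orth_proj (range K) u)" for u
    by (rule cinner_ext)
      (simp add: cadjoint[OF K, symmetric] cinner_orth_proj_right[OF V])
  then show eq: "range (cadjoint K) = cadjoint K ` range K"
    using orth_proj(1)[OF V] by (metis (no_types, lifting) image_iff image_subsetI
        subset_antisym UNIV_I)
  assume "g \<in> range (cadjoint K)"
  then obtain v where v: "v \<in> range K" "g = cadjoint K v"
    using eq by auto
  have "(norm g)\<^sup>2 = Re (cinner (K g) v)"
    by (simp add: cadjoint[OF K] v(2) Re_cinner_self)
  also have "\<dots> \<le> norm (K g) * norm v"
    by (rule Re_cinner_le)
  finally have "c * (norm g)\<^sup>2 \<le> c * (norm (K g) * norm v)"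
    using \<open>c > 0\<close> by simp
  also have "\<dots> = norm (K g) * (c * norm v)"
    by simp
  also have "\<dots> \<le> norm (K g) * norm g"
    using below[OF v(1)] v(2) by (intro mult_left_mono) auto
  finally show "c * norm g \<le> norm (K g)"
    by (cases "norm g = 0") (simp_all add: power2_eq_square)
qed

text \<open>A linear map bounded below on a complete subspace has complete image.\<close>

lemma closed_range_cadjoint:
  fixes K :: "'a::complex_hilbert \<Rightarrow> 'b::complex_hilbert"
  assumes K: "bounded_clinear K" and cl: "closed (range K)"
  shows "closed (range (cadjoint K))"
proof -
  obtain c where c: "c > 0" "\<And>v. v \<in> range K \<Longrightarrow> c * norm v \<le> norm (cadjoint K v)"
    using closed_range_imp_cadjoint_bounded_below[OF K cl] by blast
  have "complete (cadjoint K ` range K)"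
    by (rule complete_isometric_image[OF c(1)])
      (use c(2) csubspace_range[OF K] bounded_clinear_linear[OF bounded_clinear_cadjoint[OF K]] cl
        in \<open>auto simp: csubspace_def complete_eq_closed\<close>)
  then show ?thesis
    using bounded_below_on_range_cadjoint(1)[OF K cl c] by (simp add: complete_imp_closed)
qed

section \<open>Inverting a coercive operator on a closed subspace\<close>

text \<open>Coercivity makes \<open>A\<close> injective on \<open>V\<close> with closed image, and
  leaves no nonzero vector of \<open>V\<close> orthogonal to that image. \<open>B\<close> first
  projects onto \<open>V\<close> and then inverts, so it is an operator on the whole space.\<close>

lemma lax_milgram:
  fixes A :: "'a::complex_hilbert \<Rightarrow> 'a"
  assumes V: "csubspace V" "closed V" and A: "bounded_clinear A" "\<And>x. A x \<in> V"
    and "a > 0" and coercive: "\<And>x. x \<in> V \<Longrightarrow> a * (norm x)\<^sup>2 \<le> Re (cinner (A x) x)"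
  obtains B where "bounded_clinear B" "\<And>x. B x \<in> V" "\<And>x. A (B x) = orth_proj V x"
    "\<And>x v. v \<in> V \<Longrightarrow> orth_proj V x = A v \<Longrightarrow> B x = v"
proof -
  interpret A: bounded_linear A
    using A(1) by (rule bounded_clinear_linear)
  note sub = V(1)[unfolded csubspace_def]
  have below: "a * norm x \<le> norm (A x)" if "x \<in> V" for x
  proof -
    have "a * norm x * norm x \<le> norm (A x) * norm x"
      using coercive[OF that] Re_cinner_le[of "A x" x] by (simp add: power2_eq_square mult.assoc)
    then show ?thesis
      by (cases "norm x = 0") (simp_all add: mult_le_cancel_right)
  qed
  have inj: "x = y" if "x \<in> V" "y \<in> V" "A x = A y" for x y
  proof -
    have "a * norm (x - y) \<le> 0"
      using below[of "x - y"] sub that by (simp add: A.diff subspace_diff)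
    then show ?thesis
      using \<open>a > 0\<close> by (simp add: mult_le_0_iff)
  qed
  have "complete (A ` V)"
    by (rule complete_isometric_image[OF \<open>a > 0\<close>])
      (use below sub V(2) A.bounded_linear_axioms in \<open>auto simp: complete_eq_closed\<close>)
  then have AV: "csubspace (A ` V)" "closed (A ` V)"
    using csubspace_image[OF A(1) V(1)] by (auto simp: complete_imp_closed)
  have surj: "v \<in> A ` V" if "v \<in> V" for v
  proof -
    let ?w = "v - orth_proj (A ` V) v"
    have "orth_proj (A ` V) v \<in> V"
      using orth_proj(1)[OF AV, of v] A(2) by auto
    then have w: "?w \<in> V"
      using that sub by (simp add: subspace_diff)
    \<comment> \<open>The residual is orthogonal to the image of \<open>V\<close>, in particular to
      its own image, so coercivity forces it to vanish.\<close>
    then have "cinner ?w (A ?w) = 0"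
      by (intro orth_proj(2)[OF AV]) auto
    then have "cinner (A ?w) ?w = 0"
      by (metis cinner_commute complex_cnj_zero)
    then have "?w = 0"
      using coercive[OF w] \<open>a > 0\<close> by (simp add: mult_le_0_iff)
    then show ?thesis
      using orth_proj(1)[OF AV, of v] by simp
  qed
  then have "\<exists>y\<in>V. A y = orth_proj V x" for x
    using orth_proj(1)[OF V, of x] by (metis imageE)
  then obtain B where B: "\<And>x. B x \<in> V" "\<And>x. A (B x) = orth_proj V x"
    by metis
  have unique: "B x = v" if "v \<in> V" "orth_proj V x = A v" for x v
    using inj B that by simp
  have P: "bounded_clinear (orth_proj V)"
    using V by (rule bounded_clinear_orth_proj)
  show thesis
  proof
    show "bounded_clinear B"
    proof (rule bounded_clinearI[where B = "1 / a"])
      show "B (x + y) = B x + B y" for x y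
        by (rule unique)
          (use B sub linear_add[OF bounded_linear.linear[OF bounded_clinear_linear[OF P]]]
            in \<open>auto simp: subspace_add A.add\<close>)
      show "B (c *\<^sub>C x) = c *\<^sub>C B x" for c x
        by (rule unique)
          (use B sub in \<open>auto simp: bounded_clinear_scaleC[OF P] bounded_clinear_scaleC[OF A(1)]\<close>)
      have "a * norm (B x) \<le> norm x" for x
        using below[OF B(1), of x] norm_orth_proj_le[OF V, of x] by (simp add: B(2))
      then show "norm (B x) \<le> norm x * (1 / a)" for x
        using \<open>a > 0\<close> by (simp add: field_simps)
    qed
  qed (fact B unique)+
qed

section \<open>Multipliers of Bessel sequences\<close>

lemma multiplier_one_has_sum:
  assumes "bessel I F" "bessel I G"
  shows "((\<lambda>i. cinner f (G i) *\<^sub>C F i) has_sum multiplier I (\<lambda>_. 1) F G f) I"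
  using has_sum_infsum[OF multiplier_one_summable[OF assms, of f]]
  by (simp add: multiplier_def)

lemma multiplier_one_cinner_has_sum:
  assumes "bessel I F" "bessel I G"
  shows "((\<lambda>i. cinner f (G i) * cinner (F i) w) has_sum
    cinner (multiplier I (\<lambda>_. 1) F G f) w) I"
  using has_sum_bounded_linear[OF bounded_linear_cinner_left[of w]
      multiplier_one_has_sum[OF assms, of f]]
  by (simp add: cinner_scaleC_left)

text \<open>A multiplier sees its argument only through the coefficients; this is how the range
  inclusions are exploited.\<close>

lemma multiplier_one_cong_analysis:
  assumes "analysis I G f = analysis I H g"
  shows "multiplier I (\<lambda>_. 1) F G f = multiplier I (\<lambda>_. 1) F H g"
proof -
  have "cinner f (G i) = cinner g (H i)" if "i \<in> I" for i
    using fun_cong[OF assms, of i] that by (simp add: analysis_def)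
  then show ?thesis
    by (simp add: multiplier_def cong: infsum_cong)
qed

lemma bounded_clinear_multiplier_one:
  fixes F G :: "'i \<Rightarrow> 'a::complex_hilbert"
  assumes F: "bessel I F" and G: "bessel I G"
  shows "bounded_clinear (multiplier I (\<lambda>_. 1) F G)"
proof -
  let ?N = "multiplier I (\<lambda>_. 1) F G"
  note N = multiplier_one_cinner_has_sum[OF F G]
  obtain BF where BF: "BF > 0" "\<And>f. (\<lambda>i. (cmod (cinner f (F i)))\<^sup>2) summable_on I"
      "\<And>f. (\<Sum>\<^sub>\<infinity>i\<in>I. (cmod (cinner f (F i)))\<^sup>2) \<le> BF * (norm f)\<^sup>2"
    using F by (auto simp: bessel_def)
  obtain BG where BG: "BG > 0" "\<And>f. (\<lambda>i. (cmod (cinner f (G i)))\<^sup>2) summable_on I"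
      "\<And>f. (\<Sum>\<^sub>\<infinity>i\<in>I. (cmod (cinner f (G i)))\<^sup>2) \<le> BG * (norm f)\<^sup>2"
    using G by (auto simp: bessel_def)
  show ?thesis
  proof (rule bounded_clinearI[where B = "sqrt (BF * BG)"])
    show "?N (x + y) = ?N x + ?N y" for x y
    proof (rule has_sum_unique)
      show "((\<lambda>i. cinner x (G i) *\<^sub>C F i + cinner y (G i) *\<^sub>C F i) has_sum ?N x + ?N y) I"
        by (intro has_sum_add multiplier_one_has_sum F G)
      show "((\<lambda>i. cinner x (G i) *\<^sub>C F i + cinner y (G i) *\<^sub>C F i) has_sum ?N (x + y)) I"
        using multiplier_one_has_sum[OF F G, of "x + y"]
        by (simp add: cinner_add_left scaleC_add_left)
    qed
    show "?N (c *\<^sub>C x) = c *\<^sub>C ?N x" for c x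
    proof -
      \<comment> \<open>Pairing with \<open>w\<close> reduces homogeneity to scaling a series of
        complex numbers.\<close>
      have "cinner (?N (c *\<^sub>C x)) w = cinner (c *\<^sub>C ?N x) w" for w
        using N[of "c *\<^sub>C x" w] has_sum_cmult_right[OF N[of x w], of c]
        by (intro has_sum_unique) (simp_all add: cinner_scaleC_left mult.assoc)
      then show ?thesis
        by (metis cinner_commute cinner_ext)
    qed
    show "norm (?N f) \<le> norm f * sqrt (BF * BG)" for f
    proof -
      let ?v = "?N f"
      let ?g = "\<lambda>i. (cmod (cinner f (G i)))\<^sup>2" and ?h = "\<lambda>i. (cmod (cinner ?v (F i)))\<^sup>2"
      \<comment> \<open>Young's inequality with weight \<open>BF\<close>: by the Bessel bound of
        \<open>F\<close> the second term is at most half the square of \<open>norm ?v\<close> and is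
        absorbed on the left.\<close>
      have "norm (cinner ?v ?v) \<le> BF / 2 * infsum ?g I + 1 / (2 * BF) * infsum ?h I"
      proof (rule norm_infsum_le[OF N])
        show "((\<lambda>i. BF / 2 * ?g i + 1 / (2 * BF) * ?h i) has_sum
            (BF / 2 * infsum ?g I + 1 / (2 * BF) * infsum ?h I)) I"
          by (intro has_sum_add has_sum_cmult_right has_sum_infsum BF BG)
        fix i
        have "0 \<le> (BF * cmod (cinner f (G i)) - cmod (cinner ?v (F i)))\<^sup>2 / (2 * BF)"
          using BF(1) by simp
        then have "cmod (cinner f (G i)) * cmod (cinner ?v (F i))
            \<le> BF / 2 * ?g i + 1 / (2 * BF) * ?h i"
          using BF(1) by (simp add: power2_diff field_simps power2_eq_square)
        then show "norm (cinner f (G i) * cinner (F i) ?v)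
            \<le> BF / 2 * ?g i + 1 / (2 * BF) * ?h i"
          by (simp add: norm_mult cinner_commute[of "F i" ?v])
      qed
      also have "\<dots> \<le> BF / 2 * (BG * (norm f)\<^sup>2) + 1 / (2 * BF) * (BF * (norm ?v)\<^sup>2)"
        using BF BG by (intro add_mono mult_left_mono) auto
      finally have "(norm ?v)\<^sup>2 \<le> BF * BG * (norm f)\<^sup>2"
        using BF(1) by (simp add: cinner_self norm_power field_simps)
      also have "\<dots> = (norm f * sqrt (BF * BG))\<^sup>2"
        using BF(1) BG(1) by (simp add: power_mult_distrib)
      finally show ?thesis
        using BF(1) BG(1) by (intro power2_le_imp_le[of "norm ?v"]) auto
    qed
  qed
qed

text \<open>Identifies the quadratic form of the frame operator, so that a lower frame bound becomes
  coercivity.\<close>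

lemma Re_cinner_multiplier_one_self:
  assumes "bessel I F"
  shows "Re (cinner (multiplier I (\<lambda>_. 1) F F f) f) = (\<Sum>\<^sub>\<infinity>i\<in>I. (cmod (cinner f (F i)))\<^sup>2)"
proof -
  have "Re (cinner f (F i) * cinner (F i) f) = (cmod (cinner f (F i)))\<^sup>2" for i
    unfolding cinner_commute[of "F i" f] complex_norm_square[symmetric] by simp
  then show ?thesis
    using has_sum_Re[OF multiplier_one_cinner_has_sum[OF assms assms, of f f]]
    by (simp add: infsumI)
qed

text \<open>Continuity moves \<open>X\<close> onto the vectors \<open>F i\<close>, and the adjoint
  moves \<open>Y\<close> onto the vectors \<open>G i\<close>; the symbol stays 1.\<close>

lemma is_multiplier_compose:
  assumes F: "bessel I F" and G: "bessel I G" and X: "bounded_clinear X" and Y: "bounded_clinear Y"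
  shows "is_multiplier I (\<lambda>f. X (multiplier I (\<lambda>_. 1) F G (Y f)))"
proof -
  have sum: "((\<lambda>i. (1 * cinner f (cadjoint Y (G i))) *\<^sub>C X (F i)) has_sum
      X (multiplier I (\<lambda>_. 1) F G (Y f))) I" for f
    using has_sum_bounded_linear[OF bounded_clinear_linear[OF X] multiplier_one_has_sum[OF F G]]
    by (simp add: bounded_clinear_scaleC[OF X] cadjoint[OF Y, symmetric])
  show ?thesis
    unfolding is_multiplier_def
  proof (intro exI conjI allI ext)
    show "(\<lambda>i. (1 * cinner f (cadjoint Y (G i))) *\<^sub>C X (F i)) summable_on I" for f
      using sum by (rule has_sum_imp_summable)
    show "X (multiplier I (\<lambda>_. 1) F G (Y f)) =
        multiplier I (\<lambda>_. 1) (\<lambda>i. X (F i)) (\<lambda>i. cadjoint Y (G i)) f" for f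
      unfolding multiplier_def[of _ _ "\<lambda>i. X (F i)"] by (rule infsumI[symmetric, OF sum])
  qed
qed

lemma multiplier_one_image:
  assumes "bessel I F" "bessel I G" "bounded_clinear X"
  shows "multiplier I (\<lambda>_. 1) (\<lambda>i. X (F i)) G f = X (multiplier I (\<lambda>_. 1) F G f)"
  using has_sum_bounded_linear[OF bounded_clinear_linear[OF assms(3)]
      multiplier_one_has_sum[OF assms(1,2), of f]]
  by (simp add: bounded_clinear_scaleC[OF assms(3)] multiplier_def infsumI)

text \<open>Lax-Milgram for the compression of the frame operator to \<open>V\<close>. The last
  conclusion carries no projection because \<open>B\<close> takes equal values on vectors with the
  same projection onto \<open>V\<close>.\<close>

lemma frame_operator_inverse:
  assumes V: "csubspace V" "closed V" and F: "bessel I F" and "a > 0"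
    and below: "\<And>v. v \<in> V \<Longrightarrow> a * (norm v)\<^sup>2 \<le> (\<Sum>\<^sub>\<infinity>i\<in>I. (cmod (cinner v (F i)))\<^sup>2)"
  obtains B where "bounded_clinear B" "\<And>x. B x \<in> V"
    "\<And>x. orth_proj V (multiplier I (\<lambda>_. 1) F F (B x)) = orth_proj V x"
    "\<And>v. v \<in> V \<Longrightarrow> B (multiplier I (\<lambda>_. 1) F F v) = v"
proof -
  let ?A = "\<lambda>x. orth_proj V (multiplier I (\<lambda>_. 1) F F x)"
  have A: "bounded_clinear ?A"
    using bounded_clinear_orth_proj[OF V] bounded_clinear_multiplier_one[OF F F]
    by (rule bounded_clinear_compose)
  have "a * (norm x)\<^sup>2 \<le> Re (cinner (?A x) x)" if "x \<in> V" for x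
    using below[OF that] that
    by (simp add: cinner_orth_proj_left[OF V] Re_cinner_multiplier_one_self[OF F])
  from V A orth_proj(1)[OF V] \<open>a > 0\<close> this show thesis
  proof (rule lax_milgram)
    fix B
    assume "bounded_clinear B" "\<And>x. B x \<in> V" "\<And>x. ?A (B x) = orth_proj V x"
      and "\<And>x v. v \<in> V \<Longrightarrow> orth_proj V x = ?A v \<Longrightarrow> B x = v"
    then show thesis
      by (intro that[of B]) simp_all
  qed
qed

text \<open>Wherever the adjoint of \<open>L\<close> is bounded below, an \<open>L\<close>-frame
  satisfies an ordinary lower frame bound, with constant \<open>A\<close> times the square of
  \<open>c\<close>.\<close>

lemma op_frame_bounded_below:
  assumes "op_frame I L F" "c > 0" and below: "\<And>v. v \<in> V \<Longrightarrow> c * norm v \<le> norm (cadjoint L v)"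
  obtains a where "a > 0"
    "\<And>v. v \<in> V \<Longrightarrow> a * (norm v)\<^sup>2 \<le> (\<Sum>\<^sub>\<infinity>i\<in>I. (cmod (cinner v (F i)))\<^sup>2)"
proof -
  obtain A where A: "A > 0"
      "\<And>f. A * (norm (cadjoint L f))\<^sup>2 \<le> (\<Sum>\<^sub>\<infinity>i\<in>I. (cmod (cinner f (F i)))\<^sup>2)"
    using assms(1) by (auto simp: op_frame_def)
  have "A * c\<^sup>2 * (norm v)\<^sup>2 \<le> (\<Sum>\<^sub>\<infinity>i\<in>I. (cmod (cinner v (F i)))\<^sup>2)" if "v \<in> V" for v
  proof -
    have "(c * norm v)\<^sup>2 \<le> (norm (cadjoint L v))\<^sup>2"
      using below[OF that] \<open>c > 0\<close> by (intro power_mono) auto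
    then have "A * (c * norm v)\<^sup>2 \<le> A * (norm (cadjoint L v))\<^sup>2"
      using A(1) by simp
    then show ?thesis
      using A(2)[of v] by (simp add: power_mult_distrib mult.assoc)
  qed
  then show thesis
    using A(1) \<open>c > 0\<close> by (intro that[of "A * c\<^sup>2"]) auto
qed

section \<open>One-sided inverses relative to \<open>K\<close>\<close>

theorem theorem3p7:
  fixes I :: "'i set"
    and K :: "'a::complex_hilbert \<Rightarrow> 'a"
    and \<Psi> \<Phi> :: "'i \<Rightarrow> 'a"
  assumes "countable I"
    and "separable_space (euclidean :: 'a topology)"
    and "bounded_clinear K"
    and "closed (range K)"
    and "op_frame I K \<Psi>"
    and "op_frame I (cadjoint K) \<Phi>"
  shows "(range (analysis I \<Psi>) \<subseteq> range (analysis I \<Phi> \<circ> cadjoint K) \<longrightarrow>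
           (\<exists>R. is_multiplier I R \<and>
             (\<forall>f. multiplier I (\<lambda>_. 1) (\<lambda>i. orth_proj (range K) (\<Psi> i)) \<Phi> (R f) = K f)))
       \<and> (range (analysis I \<Phi>) \<subseteq> range (analysis I \<Psi> \<circ> K) \<longrightarrow>
           (\<exists>L. is_multiplier I L \<and>
             (\<forall>f \<in> range (cadjoint K). L (multiplier I (\<lambda>_. 1) \<Psi> \<Phi> f) = K f)))"
proof -
  note K = \<open>bounded_clinear K\<close> and cl = \<open>closed (range K)\<close>
  let ?V = "range K" and ?U = "range (cadjoint K)" and ?N = "multiplier I (\<lambda>_. 1)"
  note V = csubspace_range[OF K] cl
  have U: "csubspace ?U" "closed ?U"
    using csubspace_range[OF bounded_clinear_cadjoint[OF K]] closed_range_cadjoint[OF K cl] .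
  have \<Psi>: "bessel I \<Psi>" and \<Phi>: "bessel I \<Phi>"
    using assms(5,6) by (auto intro: op_frame_imp_bessel)
  obtain c where c: "c > 0" "\<And>v. v \<in> ?V \<Longrightarrow> c * norm v \<le> norm (cadjoint K v)"
    using closed_range_imp_cadjoint_bounded_below[OF K cl] by blast
  \<comment> \<open>The projected right inverse property of \<open>B\<close> serves the first
    assertion, its left inverse property the second.\<close>
  obtain B where B: "bounded_clinear B"
      "\<And>x. orth_proj ?V (?N \<Psi> \<Psi> (B x)) = orth_proj ?V x" "\<And>v. v \<in> ?V \<Longrightarrow> B (?N \<Psi> \<Psi> v) = v"
    by (rule op_frame_bounded_below[OF assms(5) c])
      (auto intro: frame_operator_inverse[OF V \<Psi>])
  \<comment> \<open>The frame \<open>\<Phi>\<close> is controlled from below by \<open>K\<close>,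
    which on \<open>?U\<close> has the same lower bound \<open>c\<close>.\<close>
  have "c * norm g \<le> norm (cadjoint (cadjoint K) g)" if "g \<in> ?U" for g
    using bounded_below_on_range_cadjoint(2)[OF K cl c that] by (simp add: cadjoint_cadjoint[OF K])
  note cU = c(1) this
  obtain C where C: "bounded_clinear C" "\<And>u. u \<in> ?U \<Longrightarrow> C (?N \<Phi> \<Phi> u) = u"
    by (rule op_frame_bounded_below[OF assms(6) cU])
      (auto intro: frame_operator_inverse[OF U \<Phi>])
  show ?thesis
  proof (intro conjI impI)
    assume sub: "range (analysis I \<Psi>) \<subseteq> range (analysis I \<Phi> \<circ> cadjoint K)"
    define R where "R f = C (?N \<Phi> \<Psi> (B (K f)))" for f
    have "is_multiplier I R"
      unfolding R_def[abs_def]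
      by (rule is_multiplier_compose[OF \<Phi> \<Psi> C(1) bounded_clinear_compose[OF B(1) K]])
    moreover have "?N (\<lambda>i. orth_proj ?V (\<Psi> i)) \<Phi> (R f) = K f" for f
    proof -
      \<comment> \<open>The inclusion trades \<open>\<Psi>\<close>-coefficients for
        \<open>\<Phi>\<close>-coefficients of some \<open>y\<close> in \<open>?U\<close>, where
        \<open>C\<close> inverts the frame operator of \<open>\<Phi>\<close>; hence
        \<open>R f\<close> is \<open>y\<close>.\<close>
      obtain y where y: "y \<in> ?U" "analysis I \<Psi> (B (K f)) = analysis I \<Phi> y"
        using subsetD[OF sub rangeI[of _ "B (K f)"]] by auto
      have "R f = y"
        unfolding R_def multiplier_one_cong_analysis[OF y(2)] by (rule C(2)[OF y(1)])
      then have "?N (\<lambda>i. orth_proj ?V (\<Psi> i)) \<Phi> (R f) = orth_proj ?V (?N \<Psi> \<Phi> y)"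
        by (simp add: multiplier_one_image[OF \<Psi> \<Phi> bounded_clinear_orth_proj[OF V]])
      \<comment> \<open>Trading the coefficients back leaves the projected frame operator applied to
        \<open>B (K f)\<close>, which is the projection of \<open>K f\<close>, hence
        \<open>K f\<close>.\<close>
      also have "?N \<Psi> \<Phi> y = ?N \<Psi> \<Psi> (B (K f))"
        by (rule multiplier_one_cong_analysis[OF y(2)[symmetric]])
      finally show ?thesis
        by (simp add: B(2) orth_proj_id[OF V])
    qed
    ultimately show "\<exists>R. is_multiplier I R \<and>
        (\<forall>f. ?N (\<lambda>i. orth_proj ?V (\<Psi> i)) \<Phi> (R f) = K f)"
      by blast
  next
    assume sub: "range (analysis I \<Phi>) \<subseteq> range (analysis I \<Psi> \<circ> K)"
    define L where "L f = K (C (?N \<Phi> \<Psi> (B f)))" for f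
    have "is_multiplier I L"
      unfolding L_def[abs_def]
      by (rule is_multiplier_compose[OF \<Phi> \<Psi> bounded_clinear_compose[OF K C(1)] B(1)])
    moreover have "L (?N \<Psi> \<Phi> f) = K f" if f: "f \<in> ?U" for f
    proof -
      obtain y where y: "y \<in> ?V" "analysis I \<Phi> f = analysis I \<Psi> y"
        using subsetD[OF sub rangeI[of _ f]] by auto
      \<comment> \<open>\<open>B\<close> recovers \<open>y\<close> from its frame operator value;
        the same coefficients then turn \<open>?N \<Phi> \<Psi> y\<close> into
        \<open>?N \<Phi> \<Phi> f\<close>, from which \<open>C\<close> recovers
        \<open>f\<close>.\<close>
      have "B (?N \<Psi> \<Phi> f) = y"
        unfolding multiplier_one_cong_analysis[OF y(2)] by (rule B(3)[OF y(1)])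
      then show ?thesis
        using multiplier_one_cong_analysis[OF y(2), of \<Phi>] C(2)[OF f] by (simp add: L_def)
    qed
    ultimately show "\<exists>L. is_multiplier I L \<and> (\<forall>f\<in>?U. L (?N \<Psi> \<Phi> f) = K f)"
      by blast
  qed
qed

end
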